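(* Let $\mu$ be a Borel probability measure on $c$ that is non-aligned and fully supported. Then for $\mu^{\mathbb N}$-almost every sequence $(x^{(i)})_{i\in\mathbb N}\in c^{\mathbb N}$, the countable set $V=\{x^{(i)}\colon i\in\mathbb N\}$ is Rado.
   Context: $c$ denotes the Banach space of all convergent real sequences $x=(x_n)_{n\in\mathbb N}$ with the norm $\|x\|=\sup_n|x_n|$; write $x_\infty=\lim_{n\to\infty}x_n$. An affine coordinate hyperplane is a set $\{x\in c\colon x_j=\alpha\}$ with $j\in\mathbb N$, $\alpha\in\mathbb R$; a limit coordinate hyperplane is a set $\{x\in c\colon x_\infty=\alpha\}$ with $\alpha\in\mathbb R$. A measure $\mu$ on $c$ is non-aligned if $\mu(H)=0$ for every affine coordinate hyperplane and every limit coordinate hyperplane $H$. It is fully supported if $\mu(U)>0$ for every nonempty open set $U$. $\mu^{\mathbb N}$ is the product measure on $c^{\mathbb N}$ (i.i.d. points with law $\mu$). For a normed space $X$, a countable $V\subseteq X$, $\delta>0$ and $p\in(0,1)$, the random graph $\mathrm{LARG}(V,\delta,p)$ has vertex set $V$, and for each pair of distinct $u,v\in V$ with $\|u-v\|<\delta$ the edge $uv$ is included independently with probability $p$ (no other edges). A countable dense set $V\subseteq X$ is Rado if for every $\delta>0$ and every $p\in(0,1)$ there is a graph $\Gamma$ such that with probability $1$, $\mathrm{LARG}(V,\delta,p)$ is isomorphic to $\Gamma$. *)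

theory Defs
  imports "HOL-Probability.Probability"
begin

section \<open>The Banach space of convergent real sequences\<close>

typedef cseq = "{x :: nat \<Rightarrow> real. convergent x}"
  morphisms coord Abs_cseq
  using convergent_const by blast

setup_lifting type_definition_cseq

lemma convergent_coord: "convergent (coord x)"
  using coord[of x] by simp

lemma cseq_eqI: "(\<And>n. coord x n = coord y n) \<Longrightarrow> x = y"
  by (simp add: coord_inject[symmetric] fun_eq_iff)

lemma bdd_above_coord: "bdd_above (range (\<lambda>n. \<bar>coord x n\<bar>))"
proof -
  obtain K where "\<And>n. norm (coord x n) \<le> K"
    using convergent_imp_Bseq[OF convergent_coord[of x]] by (metis BseqE)
  then show ?thesis by (intro bdd_aboveI2[where M = K]) simp
qed

instantiation cseq :: real_vector
begin

lift_definition zero_cseq :: cseq is "\<lambda>_. 0"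
  by (rule convergent_const)

lift_definition plus_cseq :: "cseq \<Rightarrow> cseq \<Rightarrow> cseq" is "\<lambda>x y n. x n + y n"
  by (rule convergent_add)

lift_definition minus_cseq :: "cseq \<Rightarrow> cseq \<Rightarrow> cseq" is "\<lambda>x y n. x n - y n"
  by (rule convergent_diff)

lift_definition uminus_cseq :: "cseq \<Rightarrow> cseq" is "\<lambda>x n. - x n"
  by (simp add: convergent_minus_iff[symmetric])

lift_definition scaleR_cseq :: "real \<Rightarrow> cseq \<Rightarrow> cseq" is "\<lambda>r x n. r * x n"
  by (intro convergent_mult convergent_const)

instance
  by standard (transfer; simp add: fun_eq_iff algebra_simps)+

end

lemmas coord_simps [simp] =
  zero_cseq.rep_eq plus_cseq.rep_eq minus_cseq.rep_eq uminus_cseq.rep_eq scaleR_cseq.rep_eq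

instantiation cseq :: real_normed_vector
begin

definition norm_cseq :: "cseq \<Rightarrow> real"
  where "norm_cseq x = (SUP n. \<bar>coord x n\<bar>)"

definition dist_cseq :: "cseq \<Rightarrow> cseq \<Rightarrow> real"
  where "dist_cseq x y = norm (x - y)"

definition sgn_cseq :: "cseq \<Rightarrow> cseq"
  where "sgn_cseq x = x /\<^sub>R norm x"

definition uniformity_cseq :: "(cseq \<times> cseq) filter"
  where "uniformity_cseq = (INF e\<in>{0 <..}. principal {(x, y). dist x y < e})"

definition open_cseq :: "cseq set \<Rightarrow> bool"
  where "open_cseq S = (\<forall>x\<in>S. \<forall>\<^sub>F (x', y) in uniformity. x' = x \<longrightarrow> y \<in> S)"

lemma abs_coord_le_norm: "\<bar>coord x n\<bar> \<le> norm x"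
  unfolding norm_cseq_def by (rule cSUP_upper[OF _ bdd_above_coord]) simp

lemma norm_cseq_le: "(\<And>n. \<bar>coord x n\<bar> \<le> b) \<Longrightarrow> norm x \<le> b"
  unfolding norm_cseq_def by (rule cSUP_least) auto

instance
proof
  fix x y :: cseq and a :: real
  show "dist x y = norm (x - y)"
    by (rule dist_cseq_def)
  show "sgn x = x /\<^sub>R norm x"
    by (rule sgn_cseq_def)
  show "uniformity = (INF e\<in>{0 <..}. principal {(x, y :: cseq). dist x y < e})"
    by (rule uniformity_cseq_def)
  show "open S = (\<forall>x\<in>S. \<forall>\<^sub>F (x', y) in uniformity. x' = x \<longrightarrow> y \<in> S)" for S :: "cseq set"
    by (rule open_cseq_def)
  show "norm x = 0 \<longleftrightarrow> x = 0"
  proof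
    assume "norm x = 0"
    then show "x = 0"
      using abs_coord_le_norm[of x] by (intro cseq_eqI) simp
  qed (simp add: norm_cseq_def)
  show "norm (x + y) \<le> norm x + norm y"
  proof (rule norm_cseq_le)
    fix n
    show "\<bar>coord (x + y) n\<bar> \<le> norm x + norm y"
      using abs_coord_le_norm[of x n] abs_coord_le_norm[of y n] by simp
  qed
  have le: "norm (b *\<^sub>R z) \<le> \<bar>b\<bar> * norm z" for b and z :: cseq
    by (rule norm_cseq_le) (simp add: abs_mult mult_left_mono abs_coord_le_norm)
  show "norm (a *\<^sub>R x) = \<bar>a\<bar> * norm x"
  proof (cases "a = 0")
    case True
    then show ?thesis by (simp add: norm_cseq_def)
  next
    case False
    then have "\<bar>a\<bar> * norm x \<le> norm (a *\<^sub>R x)"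
      using le[of "inverse a" "a *\<^sub>R x"] by (simp add: field_simps)
    then show ?thesis using le[of a x] by linarith
  qed
qed

end

instance cseq :: banach
proof
  fix X :: "nat \<Rightarrow> cseq"
  assume X: "Cauchy X"
  have close: "\<exists>M. \<forall>m\<ge>M. \<forall>n\<ge>M. \<forall>k. \<bar>coord (X m) k - coord (X n) k\<bar> < e" if e: "e > 0" for e
  proof -
    obtain M where "\<forall>m\<ge>M. \<forall>n\<ge>M. norm (X m - X n) < e"
      using X e unfolding Cauchy_iff by meson
    then have "\<bar>coord (X m) k - coord (X n) k\<bar> < e" if "m \<ge> M" "n \<ge> M" for m n k
      using abs_coord_le_norm[of "X m - X n" k] that by (force intro: le_less_trans)
    then show ?thesis by blast
  qed
  then have "uniformly_Cauchy_on UNIV (\<lambda>m. coord (X m))"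
    by (auto simp: uniformly_Cauchy_on_def dist_real_def) blast
  then obtain l where l: "uniform_limit UNIV (\<lambda>m. coord (X m)) l sequentially"
    using Cauchy_uniformly_convergent unfolding uniformly_convergent_on_def by blast
  have "Cauchy l"
  proof (rule metric_CauchyI)
    fix e :: real assume "e > 0"
    then have "e / 3 > 0" by simp
    from uniform_limitD[OF l this] obtain m where m: "\<And>k. dist (coord (X m) k) (l k) < e / 3"
      by (auto simp: eventually_sequentially)
    obtain N where N: "\<And>i j. i \<ge> N \<Longrightarrow> j \<ge> N \<Longrightarrow> dist (coord (X m) i) (coord (X m) j) < e / 3"
      using convergent_Cauchy[OF convergent_coord[of "X m"]] \<open>e / 3 > 0\<close>
      by (meson metric_CauchyD)
    have "dist (l i) (l j) < e" if "i \<ge> N" "j \<ge> N" for i j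
      using m[of i] m[of j] N[OF that] unfolding dist_real_def by linarith
    then show "\<exists>M. \<forall>m\<ge>M. \<forall>n\<ge>M. dist (l m) (l n) < e" by blast
  qed
  then have "convergent l" by (simp add: Cauchy_convergent_iff)
  then obtain L where L: "l = coord L" using Abs_cseq_inverse[of l] by (metis mem_Collect_eq)
  have "X \<longlonglongrightarrow> L"
  proof (rule tendstoI)
    fix e :: real assume "e > 0"
    then have "e / 2 > 0" by simp
    from uniform_limitD[OF l this] show "\<forall>\<^sub>F m in sequentially. dist (X m) L < e"
    proof eventually_elim
      case (elim m)
      have "norm (X m - L) \<le> e / 2"
        using elim by (intro norm_cseq_le) (auto simp: L dist_real_def less_imp_le)
      then show ?case using \<open>e > 0\<close> by (simp add: dist_norm)
    qed
  qed
  then show "convergent X" by (rule convergentI)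
qed

definition limit_coord :: "cseq \<Rightarrow> real"
  where "limit_coord x = lim (coord x)"

definition affine_coordinate_hyperplane :: "nat \<Rightarrow> real \<Rightarrow> cseq set"
  where "affine_coordinate_hyperplane j \<alpha> = {x. coord x j = \<alpha>}"

definition limit_coordinate_hyperplane :: "real \<Rightarrow> cseq set"
  where "limit_coordinate_hyperplane \<alpha> = {x. limit_coord x = \<alpha>}"

definition non_aligned :: "cseq measure \<Rightarrow> bool"
  where "non_aligned \<mu> \<longleftrightarrow>
    (\<forall>j \<alpha>. emeasure \<mu> (affine_coordinate_hyperplane j \<alpha>) = 0) \<and>
    (\<forall>\<alpha>. emeasure \<mu> (limit_coordinate_hyperplane \<alpha>) = 0)"

definition fully_supported :: "'a::topological_space measure \<Rightarrow> bool"
  where "fully_supported \<mu> \<longleftrightarrow> (\<forall>U. open U \<and> U \<noteq> {} \<longrightarrow> emeasure \<mu> U > 0)"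


section \<open>Local-area random graphs and Rado sets\<close>

text \<open>A graph is a pair of a vertex set and a set of two-element subsets of it.\<close>

type_synonym 'a graph = "'a set \<times> 'a set set"

definition simple_graph :: "'a graph \<Rightarrow> bool"
  where "simple_graph G \<longleftrightarrow> snd G \<subseteq> {{u, v} | u v. u \<in> fst G \<and> v \<in> fst G \<and> u \<noteq> v}"

definition graph_iso :: "'a graph \<Rightarrow> 'b graph \<Rightarrow> bool"
  where "graph_iso G H \<longleftrightarrow> (\<exists>f. bij_betw f (fst G) (fst H) \<and>
    (\<forall>u\<in>fst G. \<forall>v\<in>fst G. {u, v} \<in> snd G \<longleftrightarrow> {f u, f v} \<in> snd H))"

definition close_pairs :: "'a::real_normed_vector set \<Rightarrow> real \<Rightarrow> 'a set set"
  where "close_pairs V \<delta> = {{u, v} | u v. u \<in> V \<and> v \<in> V \<and> u \<noteq> v \<and> norm (u - v) < \<delta>}"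

text \<open>The random graph with parameters \<open>V\<close>, \<open>\<delta>\<close>, \<open>p\<close> is the random variable
  \<^term>\<open>LARG V \<delta>\<close> on the probability space \<^term>\<open>LARG_space V \<delta> p\<close> of independent
  coin tosses, one for each unordered pair of distinct vertices at distance less than \<open>\<delta>\<close>.\<close>

definition LARG_space :: "'a::real_normed_vector set \<Rightarrow> real \<Rightarrow> real \<Rightarrow> ('a set \<Rightarrow> bool) measure"
  where "LARG_space V \<delta> p = (\<Pi>\<^sub>M e\<in>close_pairs V \<delta>. measure_pmf (bernoulli_pmf p))"

definition LARG :: "'a::real_normed_vector set \<Rightarrow> real \<Rightarrow> ('a set \<Rightarrow> bool) \<Rightarrow> 'a graph"
  where "LARG V \<delta> \<omega> = (V, {e \<in> close_pairs V \<delta>. \<omega> e})"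

text \<open>Since \<open>\<Gamma>\<close> only matters up to isomorphism and has to have as many vertices as \<open>V\<close>,
  taking its vertices from the type \<open>'a\<close> is no restriction.\<close>

definition rado :: "'a::real_normed_vector set \<Rightarrow> bool"
  where "rado V \<longleftrightarrow> countable V \<and> closure V = UNIV \<and>
    (\<forall>\<delta>>0. \<forall>p\<in>{0<..<1}. \<exists>\<Gamma> :: 'a graph. simple_graph \<Gamma> \<and>
      (AE \<omega> in LARG_space V \<delta> p. graph_iso (LARG V \<delta> \<omega>) \<Gamma>))"

end

theory Submission
  imports Defs
begin

text \<open>
  Two independent realisations of the random graph on \<open>V\<close> are matched by back and forth, along
  finite partial isomorphisms that also preserve \<open>\<lfloor>(u\<^sub>k - v\<^sub>k) / \<delta>\<rfloor>\<close> for every coordinate \<open>k\<close>,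
  the limit included. These integers determine which pairs are closer than \<open>\<delta>\<close>. If no
  difference lies in \<open>\<delta>\<int>\<close>, then the admissible images of a new point form a nonempty open box:
  far out, the constraints are controlled by the one at the limit. Almost surely this box
  contains a vertex with the prescribed adjacencies. Since \<open>\<mu>\<close> is non-aligned, for given \<open>\<delta>\<close> at
  most one pair of points of \<open>V\<close> has a coordinate difference in \<open>\<delta>\<int>\<close>; such a pair is never an
  edge, and the back and forth starts from the identity on it.
\<close>

section \<open>Product measures\<close>

text \<open>Independence means that the joint law is the product of the marginals; here the joint
  law is \<open>Pi\<^sub>M I M\<close> itself and the marginals are its factors.\<close>

lemma (in product_prob_space) indep_vars_components:
  assumes "I \<noteq> {}"
  shows "P.indep_vars M (\<lambda>i \<omega>. \<omega> i) I"
proof -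
  have "distr (Pi\<^sub>M I M) (Pi\<^sub>M I M) (\<lambda>x. \<lambda>i\<in>I. x i) = distr (Pi\<^sub>M I M) (Pi\<^sub>M I M) (\<lambda>x. x)"
    by (intro distr_cong) (auto simp: space_PiM PiE_def extensional_restrict)
  also have "\<dots> = Pi\<^sub>M I (\<lambda>i. distr (Pi\<^sub>M I M) (M i) (\<lambda>\<omega>. \<omega> i))"
    by (auto simp: PiM_component intro!: PiM_cong)
  finally show ?thesis
    by (subst P.indep_vars_iff_distr_eq_PiM') (use assms in auto)
qed

text \<open>Disjoint blocks give independent events, so the first \<open>N\<close> of them all fail
  with probability at most \<open>(1 - q) ^ N\<close>, which tends to 0. This serves both the
  density of the sample and the search for vertices with prescribed adjacencies.\<close>

lemma (in product_prob_space) AE_ex_box: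
  fixes J :: "nat \<Rightarrow> 'i set"
  assumes disj: "disjoint_family J" and J: "\<And>n. finite (J n)" "\<And>n. J n \<subseteq> I"
    and A: "\<And>i. i \<in> I \<Longrightarrow> A i \<in> sets (M i)"
    and q: "q > 0" "\<And>n. q \<le> (\<Prod>i\<in>J n. measure (M i) (A i))"
  shows "AE \<omega> in Pi\<^sub>M I M. \<exists>n. \<forall>i\<in>J n. \<omega> i \<in> A i"
proof (cases "\<exists>n. J n = {}")
  case True
  then obtain n where "J n = {}" ..
  then show ?thesis by (intro AE_I2 exI[of _ n]) simp
next
  case False
  then have I: "I \<noteq> {}" using J by blast
  define C where "C n = Pi\<^sub>E (J n) A" for n
  define X where "X n \<omega> = restrict \<omega> (J n)" for n and \<omega> :: "'i \<Rightarrow> 'a"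
  have ind: "P.indep_vars (\<lambda>n. Pi\<^sub>M (J n) M) X UNIV"
    using P.indep_vars_restrict[OF indep_vars_components[OF I], of UNIV J] J disj
    unfolding X_def by simp
  have C: "C n \<in> sets (Pi\<^sub>M (J n) M)" for n
    unfolding C_def using J A by (intro sets_PiM_I_finite) auto
  have X [measurable]: "X n \<in> measurable (Pi\<^sub>M I M) (Pi\<^sub>M (J n) M)" for n
    unfolding X_def using J(2) by (rule measurable_restrict_subset)
  have emb: "X n -` C n \<inter> space (Pi\<^sub>M I M) = prod_emb I M (J n) (Pi\<^sub>E (J n) A)" for n
    by (auto simp: prod_emb_def X_def C_def space_PiM)
  have good: "q \<le> P.prob (X n -` C n \<inter> space (Pi\<^sub>M I M))" for n
    unfolding emb using q(2)[of n] J A by (subst measure_PiM_emb) auto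
  define F where "F n = X n -` (space (Pi\<^sub>M (J n) M) - C n) \<inter> space (Pi\<^sub>M I M)" for n
  have F_sets: "F n \<in> sets (Pi\<^sub>M I M)" for n
    unfolding F_def using C by (intro measurable_sets[OF X]) auto
  have F: "P.prob (F n) \<le> 1 - q" for n
  proof -
    have "F n = space (Pi\<^sub>M I M) - (X n -` C n \<inter> space (Pi\<^sub>M I M))"
      unfolding F_def using measurable_space[OF X] by blast
    then show ?thesis
      using good[of n] P.prob_compl[OF measurable_sets[OF X C, of n]] by simp
  qed
  have q1: "q \<le> 1" using good[of 0] P.prob_le_1 by (rule order_trans)
  \<comment> \<open>\<open>N > 0\<close> because the intersection of no sets would be the whole type
    instead of the space of the product measure.\<close>
  have bound: "P.prob (\<Inter>n. F n) \<le> (1 - q) ^ N" if N: "N > 0" for N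
  proof -
    have "P.prob (\<Inter>n. F n) \<le> P.prob (\<Inter>n\<in>{..<N}. F n)"
      using N F_sets by (intro P.finite_measure_mono sets.finite_INT) auto
    also have "\<dots> = (\<Prod>n<N. P.prob (F n))"
      unfolding F_def using N C by (intro P.indep_varsD[OF ind]) auto
    also have "\<dots> \<le> (\<Prod>n<N. 1 - q)"
      using F by (intro prod_mono) auto
    finally show ?thesis by simp
  qed
  have "(\<lambda>N. (1 - q) ^ N) \<longlonglongrightarrow> 0"
    using q q1 by (intro LIMSEQ_realpow_zero) auto
  then have "P.prob (\<Inter>n. F n) \<le> 0"
    by (rule tendsto_lowerbound) (auto intro!: eventually_sequentiallyI[of 1] bound)
  then have "P.prob (\<Inter>n. F n) = 0"
    by (simp add: measure_le_0_iff)
  moreover have "(\<Inter>n. F n) \<in> sets (Pi\<^sub>M I M)"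
    using F_sets by blast
  ultimately have "AE \<omega> in Pi\<^sub>M I M. \<omega> \<notin> (\<Inter>n. F n)"
    by (intro AE_not_in) (auto simp: null_sets_def P.emeasure_eq_measure)
  then show ?thesis
  proof (rule AE_mp, intro AE_I2 impI)
    fix \<omega> assume \<omega>: "\<omega> \<in> space (Pi\<^sub>M I M)" "\<omega> \<notin> (\<Inter>n. F n)"
    then obtain n where "X n \<omega> \<in> C n"
      using measurable_space[OF X] unfolding F_def by blast
    then show "\<exists>n. \<forall>i\<in>J n. \<omega> i \<in> A i"
      unfolding X_def C_def by (intro exI[of _ n]) (auto simp: PiE_def Pi_def)
  qed
qed

text \<open>Fubini: with all components other than \<open>i\<close> fixed, \<open>g\<close> is a
  constant by \<open>indep\<close>, and \<open>f\<close> avoids it almost surely.\<close>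

lemma AE_PiM_component_neq:
  fixes f :: "'a \<Rightarrow> real" and g :: "(nat \<Rightarrow> 'a) \<Rightarrow> real"
  assumes \<mu>: "prob_space \<mu>"
    and f [measurable]: "f \<in> borel_measurable \<mu>"
    and g [measurable]: "g \<in> borel_measurable (\<Pi>\<^sub>M i\<in>UNIV. \<mu>)"
    and indep: "\<And>x a. g (x(i := a)) = g x"
    and null: "\<And>\<alpha>. AE a in \<mu>. f a \<noteq> \<alpha>"
  shows "AE x in (\<Pi>\<^sub>M i\<in>UNIV. \<mu>). f (x i) \<noteq> g x"
proof -
  define R where "R = (\<Pi>\<^sub>M j\<in>UNIV - {i}. \<mu>)"
  interpret R: prob_space R unfolding R_def by (rule prob_space_PiM) (rule \<mu>)
  interpret \<mu>: prob_space \<mu> by (rule \<mu>)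
  interpret S: pair_sigma_finite \<mu> R ..
  \<comment> \<open>Drawing component \<open>i\<close> and the remaining components independently
    reproduces the full product measure.\<close>
  have eq: "distr (\<mu> \<Otimes>\<^sub>M R) (\<Pi>\<^sub>M i\<in>UNIV. \<mu>) (\<lambda>(a, x). x(i := a)) = (\<Pi>\<^sub>M i\<in>UNIV. \<mu>)"
    using distr_pair_PiM_eq_PiM[of "UNIV - {i}" "\<lambda>_. \<mu>" i] \<mu> unfolding R_def
    by (simp add: insert_UNIV insert_absorb)
  have upd [measurable]: "(\<lambda>(a, x). x(i := a)) \<in> measurable (\<mu> \<Otimes>\<^sub>M R) (\<Pi>\<^sub>M i\<in>UNIV. \<mu>)"
  proof -
    have "(\<lambda>(a, x). x(i := a)) \<in> measurable (\<mu> \<Otimes>\<^sub>M R) (\<Pi>\<^sub>M i\<in>insert i (UNIV - {i}). \<mu>)"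
      unfolding R_def by measurable
    then show ?thesis by (simp add: insert_absorb)
  qed
  have pred: "Measurable.pred (\<mu> \<Otimes>\<^sub>M R)
      (\<lambda>z. f (((\<lambda>(a, x). x(i := a)) z) i) \<noteq> g ((\<lambda>(a, x). x(i := a)) z))"
    by measurable
  have "(AE a in \<mu>. AE x in R. f ((x(i := a)) i) \<noteq> g (x(i := a))) \<longleftrightarrow>
      (AE x in R. AE a in \<mu>. f ((x(i := a)) i) \<noteq> g (x(i := a)))"
    by (rule S.AE_commute) measurable
  then have "AE a in \<mu>. AE x in R. f ((x(i := a)) i) \<noteq> g (x(i := a))"
    using null by (simp add: indep)
  then have "AE z in \<mu> \<Otimes>\<^sub>M R. (\<lambda>x. f (x i) \<noteq> g x) ((\<lambda>(a, x). x(i := a)) z)"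
    using pred by (intro S.AE_pair_measure) (simp_all add: pred_def)
  moreover have "Measurable.pred (\<Pi>\<^sub>M i\<in>UNIV. \<mu>) (\<lambda>x. f (x i) \<noteq> g x)"
  proof -
    have "(\<lambda>x. f (x i)) \<in> borel_measurable (\<Pi>\<^sub>M i\<in>UNIV. \<mu>)"
      by (rule measurable_compose[OF _ f]) simp
    then show ?thesis
      using borel_measurable_neq[OF _ g] by (simp add: pred_def)
  qed
  ultimately have "AE x in distr (\<mu> \<Otimes>\<^sub>M R) (\<Pi>\<^sub>M i\<in>UNIV. \<mu>) (\<lambda>(a, x). x(i := a)). f (x i) \<noteq> g x"
    by (subst AE_distr_iff[OF upd]) (auto simp: pred_def)
  then show ?thesis unfolding eq .
qed

section \<open>Coordinates including the limit\<close>

text \<open>Index \<open>0\<close> is the limit coordinate; the ordinary coordinates are shifted by one.\<close>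

definition ecoord :: "cseq \<Rightarrow> nat \<Rightarrow> real"
  where "ecoord x k = (case k of 0 \<Rightarrow> limit_coord x | Suc n \<Rightarrow> coord x n)"

lemma ecoord_Suc [simp]: "ecoord x (Suc n) = coord x n"
  by (simp add: ecoord_def)

lemma tendsto_limit_coord: "coord x \<longlonglongrightarrow> ecoord x 0"
  using convergent_coord[of x] by (simp add: ecoord_def limit_coord_def convergent_LIMSEQ_iff)

lemma limit_coord_eqI: "coord x \<longlonglongrightarrow> l \<Longrightarrow> ecoord x 0 = l"
  using tendsto_limit_coord LIMSEQ_unique by blast

lemma tendsto_ecoord: "ecoord x \<longlonglongrightarrow> ecoord x 0"
  using tendsto_limit_coord[of x] by (subst filterlim_sequentially_Suc[symmetric]) simp

lemma ecoord_diff: "ecoord (x - y) k = ecoord x k - ecoord y k"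
proof (cases k)
  case 0
  then show ?thesis
    using tendsto_diff[OF tendsto_limit_coord[of x] tendsto_limit_coord[of y]]
    by (auto intro!: limit_coord_eqI simp: minus_cseq.rep_eq)
qed simp

lemma abs_ecoord_le_norm: "\<bar>ecoord x k\<bar> \<le> norm x"
proof (cases k)
  case 0
  have "(\<lambda>n. \<bar>coord x n\<bar>) \<longlonglongrightarrow> \<bar>ecoord x 0\<bar>"
    by (intro tendsto_rabs tendsto_limit_coord)
  then show ?thesis
    unfolding 0 by (rule LIMSEQ_le_const2) (auto simp: abs_coord_le_norm)
qed (simp add: abs_coord_le_norm)

text \<open>The strict inequality passes to the supremum because the index set with the point at
  infinity is compact.\<close>

lemma norm_less_iff_ecoord: "norm x < \<delta> \<longleftrightarrow> (\<forall>k. \<bar>ecoord x k\<bar> < \<delta>)"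
proof
  assume less: "\<forall>k. \<bar>ecoord x k\<bar> < \<delta>"
  then obtain c where c: "\<bar>ecoord x 0\<bar> < c" "c < \<delta>"
    using dense by blast
  have "(\<lambda>n. \<bar>coord x n\<bar>) \<longlonglongrightarrow> \<bar>ecoord x 0\<bar>"
    by (intro tendsto_rabs tendsto_limit_coord)
  then have "\<forall>\<^sub>F n in sequentially. \<bar>coord x n\<bar> < c"
    using c(1) by (rule order_tendstoD)
  then obtain N where N: "\<And>n. n \<ge> N \<Longrightarrow> \<bar>coord x n\<bar> < c"
    by (auto simp: eventually_sequentially)
  \<comment> \<open>The tail stays below \<open>c < \<delta>\<close>, and finitely many earlier
    coordinates are below \<delta> by assumption, so this maximum is still below \<delta>.\<close>
  define m where "m = Max (insert c ((\<lambda>n. \<bar>coord x n\<bar>) ` {..<N}))"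
  have "norm x \<le> m"
  proof (rule norm_cseq_le)
    fix n
    have "c \<le> m" unfolding m_def by simp
    moreover have "n < N \<Longrightarrow> \<bar>coord x n\<bar> \<le> m" unfolding m_def by (rule Max_ge) auto
    ultimately show "\<bar>coord x n\<bar> \<le> m" using N[of n] by linarith
  qed
  also have "m < \<delta>"
    unfolding m_def using c less[rule_format, of "Suc _"] by (subst Max_less_iff) auto
  finally show "norm x < \<delta>" .
qed (use abs_ecoord_le_norm in \<open>blast intro: le_less_trans\<close>)

lemma continuous_on_ecoord [continuous_intros]: "continuous_on A (\<lambda>x. ecoord x k)"
proof (rule continuous_onI)
  fix x :: cseq and e :: real
  assume "e > 0"
  have "dist (ecoord y k) (ecoord x k) \<le> dist y x" for y
    using abs_ecoord_le_norm[of "y - x" k] by (simp add: ecoord_diff dist_norm)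
  then show "\<exists>d>0. \<forall>y\<in>A. dist y x < d \<longrightarrow> dist (ecoord y k) (ecoord x k) \<le> e"
    using \<open>e > 0\<close> by (intro exI[of _ e]) (auto intro: order_trans less_imp_le)
qed

lemma borel_measurable_ecoord [measurable]: "(\<lambda>x. ecoord x k) \<in> borel_measurable borel"
  by (intro borel_measurable_continuous_onI continuous_on_ecoord)

lemma affine_coordinate_hyperplane_eq_ecoord:
  "affine_coordinate_hyperplane j \<alpha> = {x. ecoord x (Suc j) = \<alpha>}"
  by (simp add: affine_coordinate_hyperplane_def)

lemma limit_coordinate_hyperplane_eq_ecoord:
  "limit_coordinate_hyperplane \<alpha> = {x. ecoord x 0 = \<alpha>}"
  by (simp add: limit_coordinate_hyperplane_def ecoord_def)

lemma non_aligned_iff_ecoord: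
  "non_aligned \<mu> \<longleftrightarrow> (\<forall>k \<alpha>. emeasure \<mu> {x. ecoord x k = \<alpha>} = 0)"
  unfolding non_aligned_def affine_coordinate_hyperplane_eq_ecoord
    limit_coordinate_hyperplane_eq_ecoord
  by (metis not0_implies_Suc)

lemma non_aligned_ecoord:
  assumes "non_aligned \<mu>" "sets \<mu> = sets borel"
  shows "AE x in \<mu>. ecoord x k \<noteq> \<alpha>"
proof -
  have "{x. ecoord x k = \<alpha>} \<in> sets \<mu>"
    unfolding assms(2) by measurable
  then have "{x. ecoord x k = \<alpha>} \<in> null_sets \<mu>"
    using assms(1) unfolding non_aligned_iff_ecoord by auto
  from AE_not_in[OF this] show ?thesis by simp
qed

text \<open>Explicit points of the space are built with this: index 0 is the limit, so it must agree
  with the constant tail.\<close>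

lemma ecoord_eventually_const:
  fixes f :: "nat \<Rightarrow> real"
  assumes "\<And>k. k \<ge> K \<Longrightarrow> f k = f 0"
  obtains z where "ecoord z = f"
proof -
  have "(\<lambda>n. f (Suc n)) \<longlonglongrightarrow> f 0"
    using assms by (intro tendsto_eventually eventually_sequentiallyI[of K]) auto
  moreover from this have *: "coord (Abs_cseq (\<lambda>n. f (Suc n))) = (\<lambda>n. f (Suc n))"
    by (intro Abs_cseq_inverse) (auto simp: convergent_def)
  ultimately have "ecoord (Abs_cseq (\<lambda>n. f (Suc n))) k = f k" for k
    by (cases k) (auto intro!: limit_coord_eqI)
  then show thesis by (intro that) auto
qed

section \<open>Topology of the sequence space and density of the sample\<close>

text \<open>Adding a small multiple of the constant sequence 1 stays inside any given ball. The
  class is required later so that a dense set meets every nonempty open set infinitely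
  often.\<close>

instance cseq :: perfect_space
proof
  fix x :: cseq
  show "\<not> open {x}"
  proof
    assume "open {x}"
    then obtain e where e: "e > 0" "ball x e \<subseteq> {x}"
      unfolding open_contains_ball by blast
    obtain u where u: "ecoord u = (\<lambda>_. 1)"
      by (rule ecoord_eventually_const) simp
    have "norm u \<le> 1" using u ecoord_Suc[of u] by (intro norm_cseq_le) simp
    then have "e / 2 * norm u \<le> e / 2 * 1"
      using e(1) by (intro mult_left_mono) auto
    then have "x + (e / 2) *\<^sub>R u \<in> ball x e"
      using e(1) by (simp add: dist_norm)
    then have "u = 0" using e by auto
    then have "(1::real) = 0" using u ecoord_Suc[of u 0] by simp
    then show False by simp
  qed
qed

text \<open>Eventually constant rational sequences are dense: \<open>qs\<close> lists the initial
  terms, and \<open>q\<close> is the constant tail and hence the limit.\<close>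

lemma cseq_separable: "\<exists>D :: cseq set. countable D \<and> closure D = UNIV"
proof -
  define f where "f q qs k = (case k of 0 \<Rightarrow> real_of_rat q
    | Suc n \<Rightarrow> if n < length qs then real_of_rat (qs ! n) else real_of_rat q)"
    for q and qs :: "rat list" and k
  define g where "g q qs = (SOME z. ecoord z = f q qs)" for q qs
  have g: "ecoord (g q qs) = f q qs" for q qs
  proof -
    have "f q qs k = f q qs 0" if "k \<ge> Suc (length qs)" for k
      using that unfolding f_def by (cases k) simp_all
    then have "\<exists>z. ecoord z = f q qs"
      using ecoord_eventually_const by blast
    then show ?thesis unfolding g_def by (rule someI_ex)
  qed
  define D where "D = range (\<lambda>p. g (fst p) (snd p))"
  have approx: "\<exists>d\<in>D. dist d y < e" if e: "e > 0" for y and e :: real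
  proof -
    have "\<exists>q. \<bar>real_of_rat q - t\<bar> < e / 4" for t
    proof -
      obtain q where "t - e / 4 < real_of_rat q" "real_of_rat q < t + e / 4"
        using of_rat_dense[of "t - e / 4" "t + e / 4"] e by auto
      then have "\<bar>real_of_rat q - t\<bar> < e / 4" by linarith
      then show ?thesis ..
    qed
    then have "\<exists>h. \<forall>t. \<bar>real_of_rat (h t) - t\<bar> < e / 4" by (intro choice allI)
    then obtain h where h: "\<And>t. \<bar>real_of_rat (h t) - t\<bar> < e / 4" by blast
    have "\<forall>\<^sub>F n in sequentially. dist (coord y n) (ecoord y 0) < e / 4"
      using tendsto_limit_coord[of y] e by (intro tendstoD) auto
    then obtain N where N: "\<And>n. n \<ge> N \<Longrightarrow> \<bar>coord y n - ecoord y 0\<bar> < e / 4"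
      unfolding eventually_sequentially dist_real_def by blast
    \<comment> \<open>Initial terms are off by less than \<open>e / 4\<close>; on the tail the error
      of the rational and the distance of \<open>y\<close> from its limit add up to less than
      \<open>e / 2\<close>.\<close>
    define d where "d = g (h (ecoord y 0)) (map (\<lambda>n. h (coord y n)) [0..<N])"
    have "norm (d - y) \<le> e / 2"
    proof (rule norm_cseq_le)
      fix n
      have "coord d n = (if n < N then real_of_rat (h (coord y n)) else real_of_rat (h (ecoord y 0)))"
        unfolding d_def by (subst ecoord_Suc[symmetric], subst g) (simp add: f_def)
      then have "\<bar>coord d n - coord y n\<bar> \<le> e / 2"
      proof (cases "n < N")
        case True
        then have "coord d n = real_of_rat (h (coord y n))"
          using \<open>coord d n = _\<close> by simp
        then show ?thesis using h[of "coord y n"] e by simp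
      next
        case False
        then have "coord d n = real_of_rat (h (ecoord y 0))"
          using \<open>coord d n = _\<close> by simp
        then show ?thesis
          using h[of "ecoord y 0"] N[of n] False by linarith
      qed
      then show "\<bar>coord (d - y) n\<bar> \<le> e / 2" by (simp add: minus_cseq.rep_eq)
    qed
    then have "dist d y < e" using e by (simp add: dist_norm)
    moreover have "d \<in> D" unfolding D_def
      by (rule range_eqI[of _ _ "(h (ecoord y 0), map (\<lambda>n. h (coord y n)) [0..<N])"]) (simp add: d_def)
    ultimately show ?thesis by (rule rev_bexI[rotated])
  qed
  have "y \<in> closure D" for y
    unfolding closure_approachable by (intro allI impI approx)
  then have "closure D = UNIV" by blast
  moreover have "countable D" unfolding D_def by simp
  ultimately show ?thesis by blast
qed

text \<open>It suffices to hit countably many balls around a countable dense set. Each has positive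
  measure, so one of the independent points falls into it almost surely.\<close>

lemma AE_dense_range:
  assumes "prob_space \<mu>" "sets \<mu> = sets borel" "fully_supported \<mu>"
  shows "AE x in (\<Pi>\<^sub>M i\<in>(UNIV :: nat set). \<mu>). closure (range x) = (UNIV :: cseq set)"
proof -
  interpret \<mu>: prob_space \<mu> by fact
  interpret product_prob_space "\<lambda>_. \<mu>" "UNIV :: nat set" ..
  obtain D :: "cseq set" where D: "countable D" "closure D = UNIV"
    using cseq_separable by blast
  have hit: "AE x in (\<Pi>\<^sub>M i\<in>(UNIV :: nat set). \<mu>). \<exists>n. x n \<in> U" if "open U" "U \<noteq> {}" for U
  proof -
    have "emeasure \<mu> U > 0"
      using assms(3) that unfolding fully_supported_def by blast
    then have "measure \<mu> U > 0"
      unfolding \<mu>.emeasure_eq_measure by (simp only: ennreal_less_zero_iff)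
    moreover have "U \<in> sets \<mu>" using assms(2) that(1) by simp
    ultimately have "AE x in (\<Pi>\<^sub>M i\<in>(UNIV :: nat set). \<mu>). \<exists>n. \<forall>i\<in>{n}. x i \<in> U"
      by (intro AE_ex_box[where q = "measure \<mu> U"]) (simp_all add: disjoint_family_on_def)
    then show ?thesis by simp
  qed
  have "AE x in (\<Pi>\<^sub>M i\<in>(UNIV :: nat set). \<mu>). \<forall>d\<in>D. \<forall>m. \<exists>n. x n \<in> ball d (inverse (real (Suc m)))"
    unfolding AE_ball_countable[OF D(1)] AE_all_countable
    by (intro ballI allI hit) auto
  then show ?thesis
  proof (rule AE_mp, intro AE_I2 impI)
    fix x :: "nat \<Rightarrow> cseq"
    assume x: "\<forall>d\<in>D. \<forall>m. \<exists>n. x n \<in> ball d (inverse (real (Suc m)))"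
    have approx: "\<exists>z\<in>range x. dist z y < e" if e: "e > 0" for y e
    proof -
      obtain m where m: "inverse (real (Suc m)) < e / 2"
        using reals_Archimedean[OF half_gt_zero[OF e]] by (rule exE)
      have "y \<in> closure D" using D(2) by simp
      then obtain d where d: "d \<in> D" "dist d y < e / 2"
        using half_gt_zero[OF e] unfolding closure_approachable by blast
      obtain n where "dist d (x n) < inverse (real (Suc m))"
        using x[rule_format, OF d(1), of m] unfolding mem_ball by (rule exE)
      then have "dist (x n) y < e"
        using m d(2) dist_triangle[of "x n" y d] by (simp add: dist_commute)
      then show ?thesis by (rule bexI) simp
    qed
    have "y \<in> closure (range x)" for y
      unfolding closure_approachable by (intro allI impI approx)
    then show "closure (range x) = UNIV" by blast
  qed
qed

section \<open>Generic sequences\<close>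

text \<open>If \<delta> is a coordinate difference of two points divided by an integer
  \<open>b\<close>, the excluded equation says that some other coordinate difference is an integer
  multiple of \<delta>. Eliminating \<delta> in this way leaves countably many conditions, and each
  holds almost surely because component \<open>i\<close> is independent of the others. The index
  \<open>j\<close> may coincide with \<open>k\<close> or \<open>l\<close>.\<close>

lemma AE_generic:
  assumes \<mu>: "prob_space \<mu>" "sets \<mu> = sets borel" "non_aligned \<mu>"
  shows "AE x in (\<Pi>\<^sub>M i\<in>(UNIV :: nat set). \<mu>). \<forall>i j k l n m. \<forall>(a :: int) (b :: int). i \<notin> {j, k, l} \<longrightarrow>
    ecoord (x i) n \<noteq> ecoord (x j) n + of_int a / of_int b * (ecoord (x k) m - ecoord (x l) m)"
  unfolding AE_all_countable
proof (intro allI)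
  fix i j k l n m :: nat and a b :: int
  have [measurable]: "(\<lambda>x. ecoord x k) \<in> borel_measurable \<mu>" for k
    using borel_measurable_ecoord[of k] by (simp cong: measurable_cong_sets add: \<mu>(2))
  show "AE x in (\<Pi>\<^sub>M i\<in>UNIV. \<mu>). i \<notin> {j, k, l} \<longrightarrow>
      ecoord (x i) n \<noteq> ecoord (x j) n + of_int a / of_int b * (ecoord (x k) m - ecoord (x l) m)"
  proof (cases "i \<in> {j, k, l}")
    case False
    have "AE x in (\<Pi>\<^sub>M i\<in>UNIV. \<mu>). ecoord (x i) n \<noteq>
        ecoord (x j) n + of_int a / of_int b * (ecoord (x k) m - ecoord (x l) m)"
    proof (rule AE_PiM_component_neq[OF \<mu>(1), where f = "\<lambda>x. ecoord x n" and i = i and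
        g = "\<lambda>x. ecoord (x j) n + of_int a / of_int b * (ecoord (x k) m - ecoord (x l) m)"])
      show "(\<lambda>x. ecoord (x j) n + of_int a / of_int b * (ecoord (x k) m - ecoord (x l) m))
          \<in> borel_measurable (\<Pi>\<^sub>M i\<in>UNIV. \<mu>)"
        by measurable
      show "AE a in \<mu>. ecoord a n \<noteq> \<alpha>" for \<alpha>
        by (rule non_aligned_ecoord[OF \<mu>(3,2)])
    qed (use False in simp_all)
    then show ?thesis by simp
  qed simp
qed

text \<open>A pair at a coordinate distance in \<open>\<delta>\<int>\<close> cannot be avoided for all \<open>\<delta>\<close> at once, but for
  each \<open>\<delta>\<close> there is at most one such pair, and its points are at distance at least \<open>\<delta>\<close>.\<close>

lemma exceptional_pair:
  fixes x :: "nat \<Rightarrow> cseq"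
  assumes gen: "\<forall>i j k l n m. \<forall>(a :: int) (b :: int). i \<notin> {j, k, l} \<longrightarrow>
      ecoord (x i) n \<noteq> ecoord (x j) n + of_int a / of_int b * (ecoord (x k) m - ecoord (x l) m)"
    and \<delta>: "\<delta> > 0"
  obtains F where "finite F" "F \<noteq> {}" "F \<subseteq> range x"
    "\<And>u v. u \<in> F \<Longrightarrow> v \<in> F \<Longrightarrow> u \<noteq> v \<Longrightarrow> \<delta> \<le> norm (u - v)"
    "\<And>u v k. u \<in> range x \<Longrightarrow> v \<in> range x \<Longrightarrow> u \<noteq> v \<Longrightarrow> u \<notin> F \<or> v \<notin> F \<Longrightarrow>
      (ecoord u k - ecoord v k) / \<delta> \<notin> \<int>"
proof (cases "\<exists>u\<in>range x. \<exists>v\<in>range x. u \<noteq> v \<and> (\<exists>k. (ecoord u k - ecoord v k) / \<delta> \<in> \<int>)")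
  case False
  \<comment> \<open>Without an exceptional pair any singleton serves; \<open>F\<close> is nonempty
    so that the back and forth never starts from the empty matching.\<close>
  then show thesis by (intro that[of "{x 0}"]) auto
next
  case True
  have gen': "ecoord u n \<noteq> ecoord v n + of_int i / of_int j * (ecoord a m - ecoord b m)"
    if uv: "u \<in> range x" "v \<in> range x" "a \<in> range x" "b \<in> range x" "u \<notin> {v, a, b}"
    for u v a b n m and i j :: int
  proof -
    obtain i' j' k' l' where "u = x i'" "v = x j'" "a = x k'" "b = x l'"
      using uv(1-4) by blast
    moreover from this uv(5) have "i' \<notin> {j', k', l'}" by auto
    ultimately show ?thesis using gen[rule_format, of i' j' k' l'] by simp
  qed
  obtain a b k where ab: "a \<in> range x" "b \<in> range x" "a \<noteq> b"
      and "(ecoord a k - ecoord b k) / \<delta> \<in> \<int>"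
    using True by blast
  then obtain m :: int where m: "(ecoord a k - ecoord b k) / \<delta> = of_int m"
    by (elim Ints_cases)
  have m': "ecoord a k - ecoord b k = of_int m * \<delta>"
    using m \<delta> by (simp add: field_simps)
  \<comment> \<open>The added multiple vanishes in this instance, so distinct points differ in every
    coordinate. This rules out \<open>m = 0\<close>.\<close>
  have "ecoord a k \<noteq> ecoord b k"
    using gen'[of a b b b k 0 0] ab by simp
  then have "m \<noteq> 0" using m' by auto
  then have "\<bar>real_of_int m\<bar> \<ge> 1" by linarith
  then have "\<delta> \<le> \<bar>ecoord (a - b) k\<bar>"
    using \<delta> by (simp add: ecoord_diff m' abs_mult)
  then have norm: "\<delta> \<le> norm (a - b)"
    using abs_ecoord_le_norm order_trans by blast
  have new: "(ecoord u l - ecoord v l) / \<delta> \<notin> \<int>"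
    if uv: "u \<in> range x" "v \<in> range x" "u \<noteq> v" "u \<notin> {a, b}" for u v l
  proof
    assume "(ecoord u l - ecoord v l) / \<delta> \<in> \<int>"
    then obtain i :: int where "(ecoord u l - ecoord v l) / \<delta> = of_int i"
      by (elim Ints_cases)
    then have "ecoord u l - ecoord v l = of_int i * \<delta>"
      using \<delta> by (simp add: field_simps)
    \<comment> \<open>Substituting \<open>(ecoord a k - ecoord b k) / m\<close> for \<delta> turns a
      second exceptional relation into one that genericity excludes; \<open>v\<close> may be
      \<open>a\<close> or \<open>b\<close>.\<close>
    then have "ecoord u l = ecoord v l + of_int i / of_int m * (ecoord a k - ecoord b k)"
      using \<open>m \<noteq> 0\<close> unfolding m' by simp
    then show False using gen'[of u v a b l i m k] uv ab by blast
  qed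
  have new': "(ecoord u l - ecoord v l) / \<delta> \<notin> \<int>"
    if "u \<in> range x" "v \<in> range x" "u \<noteq> v" "v \<notin> {a, b}" for u v l
  proof -
    have "(ecoord u l - ecoord v l) / \<delta> = - ((ecoord v l - ecoord u l) / \<delta>)"
      by (simp add: minus_divide_left)
    moreover have "(ecoord v l - ecoord u l) / \<delta> \<notin> \<int>"
      using that by (intro new) auto
    ultimately show ?thesis by (simp only: minus_in_Ints_iff not_False_eq_True)
  qed
  show thesis
  proof (rule that[of "{a, b}"])
    show "\<delta> \<le> norm (u - v)" if "u \<in> {a, b}" "v \<in> {a, b}" "u \<noteq> v" for u v
      using that norm by (auto simp: norm_minus_commute)
    show "(ecoord u l - ecoord v l) / \<delta> \<notin> \<int>"
      if "u \<in> range x" "v \<in> range x" "u \<noteq> v" "u \<notin> {a, b} \<or> v \<notin> {a, b}" for u v l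
      using new new' that by blast
  qed (use ab in auto)
qed

section \<open>Existential closure of local-area random graphs\<close>

lemma close_pairs_iff:
  "{u, v} \<in> close_pairs V \<delta> \<longleftrightarrow> u \<in> V \<and> v \<in> V \<and> u \<noteq> v \<and> norm (u - v) < \<delta>"
  unfolding close_pairs_def by (auto simp: doubleton_eq_iff norm_minus_commute)

text \<open>A local form of the extension property of the infinite random graph. Only pairs closer
  than \<delta> carry a coin toss, so adjacencies are prescribed on a set \<open>B\<close> within
  \<delta> of every point of \<open>U\<close>, while \<open>U\<close> prescribes the location of the
  new vertex.\<close>

definition geometrically_ec :: "'a::real_normed_vector set \<Rightarrow> real \<Rightarrow> ('a set \<Rightarrow> bool) \<Rightarrow> bool"
  where "geometrically_ec V \<delta> \<omega> \<longleftrightarrow> (\<forall>U B S. open U \<longrightarrow> U \<noteq> {} \<longrightarrow> finite B \<longrightarrow> B \<subseteq> V \<longrightarrow>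
    (\<forall>y\<in>U. \<forall>b\<in>B. norm (y - b) < \<delta>) \<longrightarrow>
    (\<exists>y\<in>V \<inter> U. y \<notin> B \<and> (\<forall>b\<in>B. \<omega> {y, b} \<longleftrightarrow> b \<in> S)))"

text \<open>Without isolated points, deleting finitely many points from \<open>U\<close> leaves a
  nonempty open set, which a dense set must meet.\<close>

lemma infinite_dense_Int_open:
  fixes V :: "'a::{metric_space, perfect_space} set"
  assumes "closure V = UNIV" "open U" "U \<noteq> {}"
  shows "infinite (V \<inter> U)"
proof
  assume fin: "finite (V \<inter> U)"
  obtain y e where "e > 0" "ball y e \<subseteq> U"
    using assms(2,3) by (meson equals0I open_contains_ball)
  then have "infinite U"
    using islimpt_UNIV[of y] finite_subset[of "ball y e" U]
    by (auto simp: islimpt_eq_infinite_ball)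
  then have "U - V \<inter> U \<noteq> {}" using fin finite_subset[of U "V \<inter> U"] by blast
  moreover have "open (U - V \<inter> U)"
    using assms(2) fin by (intro open_Diff finite_imp_closed)
  ultimately have "(U - V \<inter> U) \<inter> V \<noteq> {}"
    using open_Int_closure_eq_empty[of "U - V \<inter> U" V] assms(1) by auto
  then show False by blast
qed

text \<open>There are infinitely many candidates in \<open>V \<inter> U - B\<close>. The pairs
  joining different candidates to \<open>B\<close> form disjoint blocks, and each block shows the
  desired pattern with probability at least \<open>q ^ card B\<close>, where
  \<open>q = min p (1 - p)\<close>.\<close>

lemma AE_LARG_extension:
  fixes V :: "'a::{real_normed_vector, perfect_space} set"
  assumes V: "closure V = UNIV" and p: "p \<in> {0<..<1}"
    and U: "open U" "U \<noteq> {}" and B: "finite B" "B \<subseteq> V" "S \<subseteq> B"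
    and near: "\<And>y b. y \<in> U \<Longrightarrow> b \<in> B \<Longrightarrow> norm (y - b) < \<delta>"
  shows "AE \<omega> in LARG_space V \<delta> p. \<exists>y\<in>V \<inter> U. y \<notin> B \<and> (\<forall>b\<in>B. \<omega> {y, b} \<longleftrightarrow> b \<in> S)"
proof -
  interpret product_prob_space "\<lambda>_ :: 'a set. measure_pmf (bernoulli_pmf p)" "close_pairs V \<delta>" ..
  have "infinite (V \<inter> U - B)"
    using infinite_dense_Int_open[OF V U] B(1) by simp
  then obtain z :: "nat \<Rightarrow> 'a" where z: "inj z" "range z \<subseteq> V \<inter> U - B"
    using infinite_countable_subset by blast
  then have zV: "z n \<in> V" "z n \<in> U" "z n \<notin> B" for n by blast+
  define J where "J n = (\<lambda>b. {z n, b}) ` B" for n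
  \<comment> \<open>The prescribed outcome as a function of the pair alone: since \<open>z n\<close>
    lies outside \<open>S\<close>, the pair \<open>{z n, b}\<close> meets \<open>S\<close> exactly
    when \<open>b\<close> is in \<open>S\<close>.\<close>
  define A :: "'a set \<Rightarrow> bool set" where "A e = (if e \<inter> S = {} then {False} else {True})" for e
  define q where "q = min p (1 - p)"
  have q: "0 < q" "q \<le> 1" using p by (auto simp: q_def)
  have meas: "q \<le> measure (measure_pmf (bernoulli_pmf p)) (A e)" for e
    using p by (simp add: A_def q_def measure_pmf_single)
  have "disjoint_family J"
    unfolding disjoint_family_on_def
  proof (intro ballI impI equals0I)
    fix n m e assume "n \<noteq> m" "e \<in> J n \<inter> J m"
    then obtain b b' where "b \<in> B" "b' \<in> B" "{z n, b} = {z m, b'}"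
      unfolding J_def by auto
    then have "z n = z m"
      using zV(3)[of n] zV(3)[of m] by (auto simp: doubleton_eq_iff)
    then show False
      using \<open>n \<noteq> m\<close> injD[OF z(1)] by blast
  qed
  moreover have "J n \<subseteq> close_pairs V \<delta>" for n
    unfolding J_def using zV[of n] B near by (auto simp: close_pairs_iff)
  moreover have "finite (J n)" for n
    unfolding J_def using B(1) by simp
  moreover have "q ^ card B \<le> (\<Prod>e\<in>J n. measure (measure_pmf (bernoulli_pmf p)) (A e))" for n
  proof -
    have "q ^ card B \<le> q ^ card (J n)"
      unfolding J_def using q B(1) by (intro power_decreasing card_image_le) auto
    also have "\<dots> = (\<Prod>e\<in>J n. q)" by simp
    also have "\<dots> \<le> (\<Prod>e\<in>J n. measure (measure_pmf (bernoulli_pmf p)) (A e))"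
      using q meas by (intro prod_mono) auto
    finally show ?thesis .
  qed
  ultimately have "AE \<omega> in LARG_space V \<delta> p. \<exists>n. \<forall>e\<in>J n. \<omega> e \<in> A e"
    unfolding LARG_space_def using q by (intro AE_ex_box[of J A "q ^ card B"]) simp_all
  then show ?thesis
  proof (rule AE_mp, intro AE_I2 impI)
    fix \<omega> :: "'a set \<Rightarrow> bool"
    assume "\<exists>n. \<forall>e\<in>J n. \<omega> e \<in> A e"
    then obtain n where n: "\<And>b. b \<in> B \<Longrightarrow> \<omega> {z n, b} \<in> A {z n, b}"
      unfolding J_def by blast
    have "\<omega> {z n, b} \<longleftrightarrow> b \<in> S" if "b \<in> B" for b
    proof -
      have "{z n, b} \<inter> S = {} \<longleftrightarrow> b \<notin> S"
        using zV(3)[of n] B(3) by blast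
      then show ?thesis using n[OF that] by (simp add: A_def split: if_splits)
    qed
    then show "\<exists>y\<in>V \<inter> U. y \<notin> B \<and> (\<forall>b\<in>B. \<omega> {y, b} \<longleftrightarrow> b \<in> S)"
      using zV[of n] by blast
  qed
qed

text \<open>Countably many instances suffice: \<open>U\<close> shrinks to a ball of radius
  \<open>1 / (n + 1)\<close> around a point of \<open>V\<close>, and \<open>B\<close> and
  \<open>S\<close> range over finite subsets of \<open>V\<close>.\<close>

lemma AE_geometrically_ec:
  fixes V :: "'a::{real_normed_vector, perfect_space} set"
  assumes V: "countable V" "closure V = UNIV" and p: "p \<in> {0<..<1}"
  shows "AE \<omega> in LARG_space V \<delta> p. geometrically_ec V \<delta> \<omega>"
proof -
  let ?r = "\<lambda>n. inverse (real (Suc n))"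
  let ?F = "{B. B \<subseteq> V \<and> finite B}"
  have "AE \<omega> in LARG_space V \<delta> p. \<forall>q\<in>V. \<forall>n. \<forall>B\<in>?F. \<forall>S\<in>?F.
      S \<subseteq> B \<longrightarrow> (\<forall>y\<in>ball q (?r n). \<forall>b\<in>B. norm (y - b) < \<delta>) \<longrightarrow>
      (\<exists>y\<in>V \<inter> ball q (?r n). y \<notin> B \<and> (\<forall>b\<in>B. \<omega> {y, b} \<longleftrightarrow> b \<in> S))"
  proof -
    have c: "countable ?F" using countable_Collect_finite_subset[OF V(1)] by (simp add: conj_commute)
    show ?thesis
      unfolding AE_ball_countable[OF V(1)] AE_ball_countable[OF c] AE_all_countable
    proof (intro ballI allI)
      fix q n B S assume *: "B \<in> ?F" "S \<in> ?F"
      show "AE \<omega> in LARG_space V \<delta> p. S \<subseteq> B \<longrightarrow>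
        (\<forall>y\<in>ball q (?r n). \<forall>b\<in>B. norm (y - b) < \<delta>) \<longrightarrow>
        (\<exists>y\<in>V \<inter> ball q (?r n). y \<notin> B \<and> (\<forall>b\<in>B. \<omega> {y, b} \<longleftrightarrow> b \<in> S))"
      proof (cases "S \<subseteq> B \<and> (\<forall>y\<in>ball q (?r n). \<forall>b\<in>B. norm (y - b) < \<delta>)")
        case True
        then have "AE \<omega> in LARG_space V \<delta> p.
            \<exists>y\<in>V \<inter> ball q (?r n). y \<notin> B \<and> (\<forall>b\<in>B. \<omega> {y, b} \<longleftrightarrow> b \<in> S)"
          using * by (intro AE_LARG_extension[OF V(2) p]) auto
        then show ?thesis by (rule AE_mp) (simp add: AE_I2)
      qed (auto intro!: AE_I2)
    qed
  qed
  then show ?thesis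
  proof (rule AE_mp, intro AE_I2 impI)
    fix \<omega> :: "'a set \<Rightarrow> bool"
    assume *: "\<forall>q\<in>V. \<forall>n. \<forall>B\<in>?F. \<forall>S\<in>?F.
      S \<subseteq> B \<longrightarrow> (\<forall>y\<in>ball q (?r n). \<forall>b\<in>B. norm (y - b) < \<delta>) \<longrightarrow>
      (\<exists>y\<in>V \<inter> ball q (?r n). y \<notin> B \<and> (\<forall>b\<in>B. \<omega> {y, b} \<longleftrightarrow> b \<in> S))"
    show "geometrically_ec V \<delta> \<omega>"
      unfolding geometrically_ec_def
    proof (intro allI impI)
      fix U B S
      assume U: "open U" "U \<noteq> {}" and B: "finite B" "B \<subseteq> V"
        and near: "\<forall>y\<in>U. \<forall>b\<in>B. norm (y - b) < \<delta>"
      obtain q where q: "q \<in> V" "q \<in> U"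
        using infinite_dense_Int_open[OF V(2) U] by (metis IntE all_not_in_conv finite.emptyI)
      obtain e where "e > 0" "ball q e \<subseteq> U"
        using U(1) q(2) open_contains_ball by blast
      moreover from this obtain n where "?r n < e" using reals_Archimedean by blast
      ultimately have n: "ball q (?r n) \<subseteq> U" using subset_ball[of "?r n" e q] by simp
      \<comment> \<open>Passing to the finite set \<open>S \<inter> B\<close> brings an arbitrary
        \<open>S\<close> under the countable family.\<close>
      have "\<exists>y\<in>V \<inter> ball q (?r n). y \<notin> B \<and> (\<forall>b\<in>B. \<omega> {y, b} \<longleftrightarrow> b \<in> S \<inter> B)"
        using * q(1) B near n by (intro *[rule_format]) (auto intro: finite_subset)
      then show "\<exists>y\<in>V \<inter> U. y \<notin> B \<and> (\<forall>b\<in>B. \<omega> {y, b} \<longleftrightarrow> b \<in> S)"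
        using n by blast
    qed
  qed
qed

section \<open>Partial isomorphisms\<close>

text \<open>Stage \<open>n\<close> puts the \<open>n\<close>-th point of \<open>V\<close> into the
  domain and the \<open>n\<close>-th point of \<open>W\<close> into the range. As \<open>Q\<close>
  relates only two pairs at a time, it passes to the union of the chain, which \<open>inj\<close>
  makes the graph of a bijection. All stages keep the seed \<open>R0\<close>, because extension is
  only assumed for matchings containing it.\<close>

lemma back_and_forth:
  fixes V :: "'a set" and W :: "'b set" and Q :: "'a \<times> 'b \<Rightarrow> 'a \<times> 'b \<Rightarrow> bool"
  assumes "countable V" "countable W"
    and R0: "finite R0" "R0 \<subseteq> V \<times> W" "\<forall>r\<in>R0. \<forall>s\<in>R0. Q r s"
    and inj: "\<And>r s. Q r s \<Longrightarrow> fst r = fst s \<longleftrightarrow> snd r = snd s"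
    and fwd: "\<And>R v. finite R \<Longrightarrow> R0 \<subseteq> R \<Longrightarrow> R \<subseteq> V \<times> W \<Longrightarrow> \<forall>r\<in>R. \<forall>s\<in>R. Q r s \<Longrightarrow> v \<in> V \<Longrightarrow>
      \<exists>w\<in>W. \<forall>r\<in>insert (v, w) R. \<forall>s\<in>insert (v, w) R. Q r s"
    and bwd: "\<And>R w. finite R \<Longrightarrow> R0 \<subseteq> R \<Longrightarrow> R \<subseteq> V \<times> W \<Longrightarrow> \<forall>r\<in>R. \<forall>s\<in>R. Q r s \<Longrightarrow> w \<in> W \<Longrightarrow>
      \<exists>v\<in>V. \<forall>r\<in>insert (v, w) R. \<forall>s\<in>insert (v, w) R. Q r s"
  obtains f where "bij_betw f V W" "\<And>u v. u \<in> V \<Longrightarrow> v \<in> V \<Longrightarrow> Q (u, f u) (v, f v)"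
proof -
  define P where "P R \<longleftrightarrow> finite R \<and> R0 \<subseteq> R \<and> R \<subseteq> V \<times> W \<and> (\<forall>r\<in>R. \<forall>s\<in>R. Q r s)" for R
  \<comment> \<open>The membership guards cover an empty \<open>V\<close> or \<open>W\<close>, where
    \<open>from_nat_into\<close> returns an unspecified value.\<close>
  define T where "T n R R' \<longleftrightarrow> R \<subseteq> R' \<and> (from_nat_into V n \<in> V \<longrightarrow> from_nat_into V n \<in> fst ` R') \<and>
    (from_nat_into W n \<in> W \<longrightarrow> from_nat_into W n \<in> snd ` R')" for n R R'
  have stepV: "\<exists>R'. P R' \<and> R \<subseteq> R' \<and> v \<in> fst ` R'" if R: "P R" and v: "v \<in> V" for R v
  proof -
    obtain w where "w \<in> W" "\<forall>r\<in>insert (v, w) R. \<forall>s\<in>insert (v, w) R. Q r s"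
      using fwd[of R v] R v unfolding P_def by blast
    then have "P (insert (v, w) R)" using R v unfolding P_def by auto
    then show ?thesis by (intro exI[of _ "insert (v, w) R"]) auto
  qed
  have stepW: "\<exists>R'. P R' \<and> R \<subseteq> R' \<and> w \<in> snd ` R'" if R: "P R" and w: "w \<in> W" for R w
  proof -
    obtain v where "v \<in> V" "\<forall>r\<in>insert (v, w) R. \<forall>s\<in>insert (v, w) R. Q r s"
      using bwd[of R w] R w unfolding P_def by blast
    then have "P (insert (v, w) R)" using R w unfolding P_def by auto
    then show ?thesis by (intro exI[of _ "insert (v, w) R"]) auto
  qed
  have step: "\<exists>R'. P R' \<and> T n R R'" if R: "P R" for R n
  proof -
    obtain R1 where R1: "P R1" "R \<subseteq> R1" "from_nat_into V n \<in> V \<longrightarrow> from_nat_into V n \<in> fst ` R1"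
      using stepV[OF R] R by blast
    obtain R2 where "P R2" "R1 \<subseteq> R2" "from_nat_into W n \<in> W \<longrightarrow> from_nat_into W n \<in> snd ` R2"
      using stepW[OF R1(1)] R1(1) by blast
    then show ?thesis using R1 unfolding T_def by blast
  qed
  have "P R0" using R0 unfolding P_def by auto
  then have "\<exists>R. \<forall>n. P (R n) \<and> T n (R n) (R (Suc n))"
    by (intro dependent_nat_choice[where P = "\<lambda>_. P"]) (use step in blast)+
  then obtain R where R: "\<And>n. P (R n)" "\<And>n. T n (R n) (R (Suc n))" by blast
  define U where "U = (\<Union>n. R n)"
  have "incseq R" using R(2) by (intro incseq_SucI) (auto simp: T_def)
  then have UQ: "Q r s" if rs: "r \<in> U" "s \<in> U" for r s
  proof -
    obtain m n where "r \<in> R m" "s \<in> R n" using rs unfolding U_def by blast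
    then have "r \<in> R (max m n)" "s \<in> R (max m n)"
      using incseqD[OF \<open>incseq R\<close>, of m "max m n"] incseqD[OF \<open>incseq R\<close>, of n "max m n"] by auto
    then show ?thesis using R(1)[of "max m n"] unfolding P_def by blast
  qed
  have UVW: "U \<subseteq> V \<times> W" using R(1) unfolding U_def P_def by blast
  have dom: "\<exists>w. (v, w) \<in> U" if v: "v \<in> V" for v
  proof -
    obtain n where "from_nat_into V n = v"
      using from_nat_into_surj[OF \<open>countable V\<close> v] by blast
    then have "v \<in> fst ` R (Suc n)" using R(2)[of n] v unfolding T_def by auto
    then show ?thesis unfolding U_def by force
  qed
  have ran: "\<exists>v. (v, w) \<in> U" if w: "w \<in> W" for w
  proof -
    obtain n where "from_nat_into W n = w"
      using from_nat_into_surj[OF \<open>countable W\<close> w] by blast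
    then have "w \<in> snd ` R (Suc n)" using R(2)[of n] w unfolding T_def by auto
    then show ?thesis unfolding U_def by force
  qed
  define f where "f v = (SOME w. (v, w) \<in> U)" for v
  have f: "(v, f v) \<in> U" if "v \<in> V" for v
    unfolding f_def using dom[OF that] by (rule someI_ex)
  have "inj_on f V"
    using inj[OF UQ[OF f f]] by (auto intro!: inj_onI)
  moreover have "f ` V = W"
  proof
    show "f ` V \<subseteq> W" using f UVW by blast
    show "W \<subseteq> f ` V"
    proof
      fix w assume "w \<in> W"
      then obtain v where v: "(v, w) \<in> U" using ran by blast
      then have "v \<in> V" using UVW by blast
      then have "f v = w" using inj[OF UQ[OF f[OF \<open>v \<in> V\<close>] v]] by simp
      then show "w \<in> f ` V" using \<open>v \<in> V\<close> by blast
    qed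
  qed
  ultimately show thesis
    using UQ f by (intro that[of f]) (auto simp: bij_betw_def)
qed

section \<open>Floors, intervals and open boxes\<close>

text \<open>For a non-integer \<open>s\<close> the floor of \<open>- s\<close> is
  \<open>- \<lfloor>s\<rfloor> - 1\<close>. Thus equality of floors survives exchanging the two
  points of a difference.\<close>

lemma floor_minus_cong:
  fixes s t :: real
  assumes "s \<notin> \<int>" "t \<notin> \<int>" "\<lfloor>s\<rfloor> = \<lfloor>t\<rfloor>"
  shows "\<lfloor>- s\<rfloor> = \<lfloor>- t\<rfloor>"
proof -
  have "of_int \<lfloor>s\<rfloor> \<noteq> s" "of_int \<lfloor>t\<rfloor> \<noteq> t" using assms(1,2) Ints_of_int by metis+
  then show ?thesis using assms(3) by (simp add: floor_minus ceiling_altdef)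
qed

text \<open>As \<open>t / \<delta>\<close> is not -1, the open interval from -1 to 1 may be replaced
  by the half-open one, a union of two floor cells.\<close>

lemma abs_less_iff_floor:
  fixes t \<delta> :: real
  assumes "\<delta> > 0" "t / \<delta> \<notin> \<int>"
  shows "\<bar>t\<bar> < \<delta> \<longleftrightarrow> \<lfloor>t / \<delta>\<rfloor> \<in> {-1, 0}"
proof -
  have "t / \<delta> \<noteq> -1" using assms(2) by (metis Ints_1 Ints_minus)
  then have "\<bar>t\<bar> < \<delta> \<longleftrightarrow> -1 \<le> t / \<delta> \<and> t / \<delta> < 1"
    using assms(1) by (auto simp: field_simps abs_less_iff less_le)
  also have "\<dots> \<longleftrightarrow> \<lfloor>t / \<delta>\<rfloor> \<in> {-1, 0}"
    by (auto simp: floor_eq_iff)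
  finally show ?thesis .
qed

lemma finite_positive_lower_bound:
  fixes h :: "'a \<Rightarrow> real"
  assumes "finite S" "\<And>s. s \<in> S \<Longrightarrow> h s > 0"
  obtains e where "e > 0" "\<And>s. s \<in> S \<Longrightarrow> e < h s"
proof -
  \<comment> \<open>The inserted 1 covers an empty \<open>S\<close>; halving below makes the bound
    strict.\<close>
  define m where "m = Min (insert 1 (h ` S))"
  have "m > 0" unfolding m_def using assms by (subst Min_gr_iff) auto
  moreover have "m / 2 < h s" if "s \<in> S" for s
  proof -
    have "m \<le> h s" unfolding m_def using assms(1) that by (intro Min_le) auto
    then show ?thesis using \<open>m > 0\<close> by linarith
  qed
  ultimately show thesis by (intro that[of "m / 2"]) auto
qed

text \<open>The Helly property on the line: the largest lower end lies below the smallest upper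
  end.\<close>

lemma finite_interpolation:
  fixes lo hi :: "'a \<Rightarrow> real"
  assumes "finite R" "R \<noteq> {}" "\<And>r s. r \<in> R \<Longrightarrow> s \<in> R \<Longrightarrow> lo r < hi s"
  shows "\<exists>t. \<forall>r\<in>R. lo r < t \<and> t < hi r"
proof -
  have "Max (lo ` R) < Min (hi ` R)"
    using assms by (subst Max_less_iff) (auto simp: Min_gr_iff)
  then obtain t where "Max (lo ` R) < t" "t < Min (hi ` R)" using dense by blast
  then show ?thesis using assms(1,2) by (auto simp: Max_less_iff Min_gr_iff)
qed

text \<open>The box is open because all but finitely many of its constraints follow, with a uniform
  margin, from the constraint at the limit coordinate.\<close>

lemma ball_in_ecoord_box:
  fixes lo hi :: "'r \<Rightarrow> nat \<Rightarrow> real"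
  assumes R: "finite R" "R \<noteq> {}"
    and less: "\<And>r s k. r \<in> R \<Longrightarrow> s \<in> R \<Longrightarrow> lo r k < hi s k"
    and lo: "\<And>r. r \<in> R \<Longrightarrow> lo r \<longlonglongrightarrow> lo r 0" and hi: "\<And>r. r \<in> R \<Longrightarrow> hi r \<longlonglongrightarrow> hi r 0"
  obtains z e where "e > 0" "\<And>y r k. y \<in> ball z e \<Longrightarrow> r \<in> R \<Longrightarrow> lo r k < ecoord y k \<and> ecoord y k < hi r k"
proof -
  have "\<exists>t. \<forall>r\<in>R. lo r k < t \<and> t < hi r k" for k
    by (rule finite_interpolation[OF R less])
  then have "\<exists>t. \<forall>k. \<forall>r\<in>R. lo r k < t k \<and> t k < hi r k" by (intro choice allI)
  then obtain t where t: "\<And>k r. r \<in> R \<Longrightarrow> lo r k < t k \<and> t k < hi r k" by blast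
  obtain e0 where e0: "e0 > 0" "\<And>r. r \<in> R \<Longrightarrow> e0 < min (t 0 - lo r 0) (hi r 0 - t 0)"
    by (rule finite_positive_lower_bound[OF R(1), of "\<lambda>r. min (t 0 - lo r 0) (hi r 0 - t 0)"])
      (use t in auto)
  have "\<forall>\<^sub>F k in sequentially. lo r k < t 0 - e0 \<and> t 0 + e0 < hi r k" if "r \<in> R" for r
    using order_tendstoD(2)[OF lo[OF that], of "t 0 - e0"]
      order_tendstoD(1)[OF hi[OF that], of "t 0 + e0"] e0(2)[OF that]
    by (intro eventually_conj) auto
  then have "\<forall>\<^sub>F k in sequentially. \<forall>r\<in>R. lo r k < t 0 - e0 \<and> t 0 + e0 < hi r k"
    using R(1) by (intro eventually_ball_finite) auto
  then obtain K where K: "\<And>k r. k \<ge> K \<Longrightarrow> r \<in> R \<Longrightarrow> lo r k < t 0 - e0 \<and> t 0 + e0 < hi r k"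
    unfolding eventually_sequentially by blast
  obtain e1 where e1: "e1 > 0" "\<And>p. p \<in> {..<K} \<times> R \<Longrightarrow>
      e1 < min (t (fst p) - lo (snd p) (fst p)) (hi (snd p) (fst p) - t (fst p))"
    by (rule finite_positive_lower_bound[of "{..<K} \<times> R"
          "\<lambda>p. min (t (fst p) - lo (snd p) (fst p)) (hi (snd p) (fst p) - t (fst p))"])
      (use t R(1) in auto)
  \<comment> \<open>Beyond \<open>K\<close> the value \<open>t 0\<close> has margin
    \<open>e0\<close> in every constraint; the finitely many earlier indices have margin
    \<open>e1\<close>. At index 0 both branches give \<open>t 0\<close>, so the limit is
    consistent.\<close>
  obtain z where z: "ecoord z = (\<lambda>k. if k < K then t k else t 0)"
    using ecoord_eventually_const[of K "\<lambda>k. if k < K then t k else t 0"] by auto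
  show thesis
  proof (rule that[of "min e0 e1" z])
    fix y r k
    assume y: "y \<in> ball z (min e0 e1)" and r: "r \<in> R"
    have "\<bar>ecoord y k - ecoord z k\<bar> < min e0 e1"
      using abs_ecoord_le_norm[of "y - z" k] y
      by (simp add: ecoord_diff dist_norm norm_minus_commute)
    then show "lo r k < ecoord y k \<and> ecoord y k < hi r k"
      using K[of k r] e1(2)[of "(k, r)"] r unfolding z
      by (cases "k < K") (auto simp: abs_less_iff)
  qed (use e0 e1 in auto)
qed

section \<open>One-point extension of compatible matchings\<close>

text \<open>A pair consists of a vertex and its image. The floors carry more than closeness: they
  ensure that the intervals allowed for the image of a further point have a common point.\<close>

definition compatible :: "real \<Rightarrow> cseq set set \<Rightarrow> cseq set set \<Rightarrow> cseq \<times> cseq \<Rightarrow> cseq \<times> cseq \<Rightarrow> bool"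
  where "compatible \<delta> E E' r s \<longleftrightarrow> (fst r = fst s \<longleftrightarrow> snd r = snd s) \<and>
    (\<forall>k. \<lfloor>(ecoord (fst r) k - ecoord (fst s) k) / \<delta>\<rfloor> = \<lfloor>(ecoord (snd r) k - ecoord (snd s) k) / \<delta>\<rfloor>) \<and>
    ({fst r, fst s} \<in> E \<longleftrightarrow> {snd r, snd s} \<in> E')"

text \<open>Reduces going back to going forth with the two graphs exchanged.\<close>

lemma compatible_swap:
  "compatible \<delta> E E' (prod.swap r) (prod.swap s) \<longleftrightarrow> compatible \<delta> E' E r s"
  unfolding compatible_def by auto

lemma snd_LARG_iff:
  "{u, v} \<in> snd (LARG V \<delta> \<omega>) \<longleftrightarrow> u \<in> V \<and> v \<in> V \<and> u \<noteq> v \<and> norm (u - v) < \<delta> \<and> \<omega> {u, v}"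
  by (auto simp: LARG_def close_pairs_iff)

text \<open>Closeness is decided coordinate by coordinate, limit included, and off the integers each
  coordinate condition is read off from the floor.\<close>

lemma norm_less_cong_floor:
  assumes "\<delta> > 0" "\<And>k. (ecoord u k - ecoord v k) / \<delta> \<notin> \<int>" "\<And>k. (ecoord u' k - ecoord v' k) / \<delta> \<notin> \<int>"
    "\<And>k. \<lfloor>(ecoord u k - ecoord v k) / \<delta>\<rfloor> = \<lfloor>(ecoord u' k - ecoord v' k) / \<delta>\<rfloor>"
  shows "norm (u - v) < \<delta> \<longleftrightarrow> norm (u' - v') < \<delta>"
  unfolding norm_less_iff_ecoord ecoord_diff
  using abs_less_iff_floor[OF assms(1) assms(2)] abs_less_iff_floor[OF assms(1) assms(3)] assms(4)
  by simp

text \<open>For each \<open>r\<close> in \<open>R\<close>, coordinate \<open>k\<close> of the image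
  must lie between \<open>lo r k\<close> and \<open>lo r k + \<delta>\<close>. These intervals
  define a box containing a ball, and \<open>ec\<close> finds in it a vertex with the required
  adjacencies. Since \<open>F\<close> is already matched, a new \<open>v\<close> lies outside it and
  has no coordinate difference in \<open>\<delta>\<int>\<close> to a matched point.\<close>

lemma extend_compatible:
  assumes \<delta>: "\<delta> > 0" and ec: "geometrically_ec V \<delta> \<omega>'"
    and E: "E = snd (LARG V \<delta> \<omega>)" "E' = snd (LARG V \<delta> \<omega>')"
    and nonint: "\<And>u v k. u \<in> V \<Longrightarrow> v \<in> V \<Longrightarrow> u \<noteq> v \<Longrightarrow> u \<notin> F \<or> v \<notin> F \<Longrightarrow>
      (ecoord u k - ecoord v k) / \<delta> \<notin> \<int>"
    and F: "F \<noteq> {}" "F \<subseteq> fst ` R"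
    and R: "finite R" "R \<subseteq> V \<times> V" "\<forall>r\<in>R. \<forall>s\<in>R. compatible \<delta> E E' r s"
    and v: "v \<in> V"
  shows "\<exists>w\<in>V. \<forall>r\<in>insert (v, w) R. \<forall>s\<in>insert (v, w) R. compatible \<delta> E E' r s"
proof (cases "v \<in> fst ` R")
  case True
  then obtain w where "(v, w) \<in> R" by force
  then show ?thesis using R(2,3) by (intro bexI[of _ w]) (auto simp: insert_absorb)
next
  case False
  then have vF: "v \<notin> F" using F(2) by blast
  have v_neq: "fst r \<noteq> v" if "r \<in> R" for r using that False by force
  have RV: "fst r \<in> V" "snd r \<in> V" if "r \<in> R" for r using that R(2) by auto
  have v_nonint: "(ecoord v k - ecoord (fst r) k) / \<delta> \<notin> \<int>" if "r \<in> R" for r k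
    using nonint[OF v RV(1)[OF that]] v_neq[OF that] vF by auto
  define n where "n r k = \<lfloor>(ecoord v k - ecoord (fst r) k) / \<delta>\<rfloor>" for r :: "cseq \<times> cseq" and k
  define lo where "lo r k = ecoord (snd r) k + \<delta> * of_int (n r k)" for r k
  \<comment> \<open>The floor is continuous off the integers, and the difference in the limit
    coordinate is not an integer multiple of \<delta>.\<close>
  have n_lim: "(\<lambda>k. real_of_int (n r k)) \<longlonglongrightarrow> of_int (n r 0)" if "r \<in> R" for r
    unfolding n_def using \<delta> v_nonint[OF that]
    by (intro tendsto_of_int_floor tendsto_intros tendsto_ecoord) auto
  have lo_lim: "lo r \<longlonglongrightarrow> lo r 0" if "r \<in> R" for r
    unfolding lo_def by (intro tendsto_intros tendsto_ecoord n_lim that)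
  have lo_less: "lo r k < lo s k + \<delta>" if r: "r \<in> R" and s: "s \<in> R" for r s k
  proof -
    have "of_int (n r k) \<le> (ecoord v k - ecoord (fst r) k) / \<delta>"
      unfolding n_def by simp
    moreover have "(ecoord v k - ecoord (fst s) k) / \<delta> < of_int (n s k) + 1"
      unfolding n_def by simp
    moreover have "(ecoord (fst r) k - ecoord (fst s) k) / \<delta> =
        (ecoord v k - ecoord (fst s) k) / \<delta> - (ecoord v k - ecoord (fst r) k) / \<delta>"
      by (simp add: diff_divide_distrib)
    ultimately have "(ecoord (fst r) k - ecoord (fst s) k) / \<delta> < of_int (n s k - n r k + 1)"
      by simp
    \<comment> \<open>Whether a real lies below a given integer depends only on its floor, so the
      bound passes from the matched points to their images.\<close>
    then have "(ecoord (snd r) k - ecoord (snd s) k) / \<delta> < of_int (n s k - n r k + 1)"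
      using R(3) r s unfolding compatible_def floor_less_iff[symmetric] by metis
    then have "ecoord (snd r) k - ecoord (snd s) k < of_int (n s k - n r k + 1) * \<delta>"
      using \<delta> by (simp only: pos_divide_less_eq)
    then show ?thesis unfolding lo_def by (simp add: algebra_simps)
  qed
  have "R \<noteq> {}" using F by auto
  obtain z e where e: "e > 0" and
    z: "\<And>y r k. y \<in> ball z e \<Longrightarrow> r \<in> R \<Longrightarrow> lo r k < ecoord y k \<and> ecoord y k < lo r k + \<delta>"
    by (rule ball_in_ecoord_box[of R lo "\<lambda>r k. lo r k + \<delta>"])
      (use R(1) \<open>R \<noteq> {}\<close> lo_less lo_lim in \<open>auto intro!: tendsto_intros\<close>)
  have between: "of_int (n r k) < (ecoord y k - ecoord (snd r) k) / \<delta>"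
    "(ecoord y k - ecoord (snd r) k) / \<delta> < of_int (n r k) + 1"
    if "y \<in> ball z e" "r \<in> R" for y r k
    using z[OF that, of k] \<delta> unfolding lo_def by (simp_all add: field_simps)
  have floor: "\<lfloor>(ecoord y k - ecoord (snd r) k) / \<delta>\<rfloor> = n r k" if "y \<in> ball z e" "r \<in> R" for y r k
    using between[OF that, of k] by (intro floor_unique) auto
  have y_nonint: "(ecoord y k - ecoord (snd r) k) / \<delta> \<notin> \<int>" if "y \<in> ball z e" "r \<in> R" for y r k
  proof
    assume "(ecoord y k - ecoord (snd r) k) / \<delta> \<in> \<int>"
    then obtain i :: int where "(ecoord y k - ecoord (snd r) k) / \<delta> = of_int i" by (elim Ints_cases)
    then show False using between(1)[OF that, of k] floor[OF that, of k] by simp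
  qed
  have near: "norm (y - snd r) < \<delta> \<longleftrightarrow> norm (v - fst r) < \<delta>" if "y \<in> ball z e" "r \<in> R" for y r
    using that by (intro norm_less_cong_floor[OF \<delta>] y_nonint v_nonint) (auto simp: floor n_def)
  \<comment> \<open>Adjacency needs prescribing only for images of points within \<delta> of
    \<open>v\<close>; by \<open>near\<close>, the other images are at distance at least \<delta>
    from the new vertex, so they are non-adjacent as required.\<close>
  define B where "B = snd ` {r \<in> R. norm (v - fst r) < \<delta>}"
  define S where "S = snd ` {r \<in> R. {v, fst r} \<in> E}"
  have "\<exists>y\<in>V \<inter> ball z e. y \<notin> B \<and> (\<forall>b\<in>B. \<omega>' {y, b} \<longleftrightarrow> b \<in> S)"
    using ec unfolding geometrically_ec_def
  proof (elim allE impE)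
    show "ball z e \<noteq> {}" using e by simp
    show "finite B" unfolding B_def using R(1) by simp
    show "B \<subseteq> V" unfolding B_def using RV(2) by blast
    show "\<forall>y\<in>ball z e. \<forall>b\<in>B. norm (y - b) < \<delta>"
      unfolding B_def using near by blast
  qed simp_all
  then obtain y where y: "y \<in> V" "y \<in> ball z e" and adj: "\<And>b. b \<in> B \<Longrightarrow> \<omega>' {y, b} \<longleftrightarrow> b \<in> S"
    by blast
  \<comment> \<open>Coinciding points would have difference 0, an integer multiple of
    \<delta>.\<close>
  have y_neq: "snd r \<noteq> y" if "r \<in> R" for r
    using y_nonint[OF y(2) that, of 0] by auto
  have edge: "{v, fst r} \<in> E \<longleftrightarrow> {y, snd r} \<in> E'" if r: "r \<in> R" for r
  proof (cases "norm (v - fst r) < \<delta>")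
    case True
    have "snd r \<in> S \<longleftrightarrow> {v, fst r} \<in> E"
    proof
      assume "snd r \<in> S"
      then obtain s where "s \<in> R" "snd s = snd r" "{v, fst s} \<in> E" unfolding S_def by auto
      \<comment> \<open>Compatibility makes the matching injective, so an image in \<open>S\<close>
        comes from the neighbour itself.\<close>
      then show "{v, fst r} \<in> E" using R(3) r unfolding compatible_def by metis
    qed (use r in \<open>auto simp: S_def\<close>)
    moreover have "snd r \<in> B" unfolding B_def using r True by blast
    ultimately show ?thesis
      using adj[of "snd r"] near[OF y(2) r] True y(1) RV[OF r] y_neq[OF r]
      unfolding E(2) snd_LARG_iff by auto
  next
    case False
    then show ?thesis using near[OF y(2) r] unfolding E snd_LARG_iff by simp
  qed
  have new: "compatible \<delta> E E' (v, y) r" if r: "r \<in> R" for r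
    unfolding compatible_def using v_neq[OF r] y_neq[OF r] floor[OF y(2) r] edge[OF r]
    by (auto simp: n_def)
  have new': "compatible \<delta> E E' r (v, y)" if r: "r \<in> R" for r
  proof -
    have "\<lfloor>(ecoord (fst r) k - ecoord v k) / \<delta>\<rfloor> = \<lfloor>(ecoord (snd r) k - ecoord y k) / \<delta>\<rfloor>" for k
      using floor_minus_cong[OF v_nonint[OF r, of k] y_nonint[OF y(2) r, of k]] floor[OF y(2) r, of k]
      by (simp add: n_def minus_divide_left)
    then show ?thesis
      unfolding compatible_def using v_neq[OF r] y_neq[OF r] edge[OF r]
      by (simp add: insert_commute)
  qed
  have "compatible \<delta> E E' (v, y) (v, y)"
    unfolding compatible_def using snd_LARG_iff[of v v] snd_LARG_iff[of y y] E by simp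
  then show ?thesis using y(1) new new' R(3) by (intro bexI[of _ y]) blast+
qed

text \<open>Back and forth seeded with the identity on \<open>F\<close>; later points have no
  coordinate difference in \<open>\<delta>\<int>\<close> to any matched point, so the extension step
  applies in both directions.\<close>

lemma LARG_iso:
  assumes V: "countable V" and \<delta>: "\<delta> > 0"
    and ec: "geometrically_ec V \<delta> \<omega>" "geometrically_ec V \<delta> \<omega>'"
    and F: "finite F" "F \<noteq> {}" "F \<subseteq> V"
    and far: "\<And>u v. u \<in> F \<Longrightarrow> v \<in> F \<Longrightarrow> u \<noteq> v \<Longrightarrow> \<delta> \<le> norm (u - v)"
    and nonint: "\<And>u v k. u \<in> V \<Longrightarrow> v \<in> V \<Longrightarrow> u \<noteq> v \<Longrightarrow> u \<notin> F \<or> v \<notin> F \<Longrightarrow>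
      (ecoord u k - ecoord v k) / \<delta> \<notin> \<int>"
  shows "graph_iso (LARG V \<delta> \<omega>) (LARG V \<delta> \<omega>')"
proof -
  let ?E = "snd (LARG V \<delta> \<omega>)" and ?E' = "snd (LARG V \<delta> \<omega>')"
  show ?thesis
  proof (rule back_and_forth[of V V "Id_on F" "compatible \<delta> ?E ?E'"])
    \<comment> \<open>Floors agree trivially under the identity, and by \<open>far\<close> neither
      graph has an edge inside \<open>F\<close>.\<close>
    show "\<forall>r\<in>Id_on F. \<forall>s\<in>Id_on F. compatible \<delta> ?E ?E' r s"
      using far by (force simp: compatible_def snd_LARG_iff Id_on_def)
    show "finite (Id_on F)" using F(1) by (simp add: Id_on_def)
    show "Id_on F \<subseteq> V \<times> V" using F(3) by blast
    show "fst r = fst s \<longleftrightarrow> snd r = snd s" if "compatible \<delta> ?E ?E' r s" for r s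
      using that unfolding compatible_def by blast
    fix R :: "(cseq \<times> cseq) set" and v
    assume R: "finite R" "Id_on F \<subseteq> R" "R \<subseteq> V \<times> V" "\<forall>r\<in>R. \<forall>s\<in>R. compatible \<delta> ?E ?E' r s"
      and v: "v \<in> V"
    \<comment> \<open>The identity seed places \<open>F\<close> in the domain and in the range, as
      needed for extension in either direction.\<close>
    have "F \<subseteq> fst ` R" "F \<subseteq> fst ` prod.swap ` R" using R(2) by force+
    then show "\<exists>w\<in>V. \<forall>r\<in>insert (v, w) R. \<forall>s\<in>insert (v, w) R. compatible \<delta> ?E ?E' r s"
      by (intro extend_compatible[OF \<delta> ec(2) refl refl nonint F(2) _ R(1,3,4) v])
    have "\<exists>u\<in>V. \<forall>r\<in>insert (v, u) (prod.swap ` R). \<forall>s\<in>insert (v, u) (prod.swap ` R).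
        compatible \<delta> ?E' ?E r s"
    proof (rule extend_compatible[OF \<delta> ec(1) refl refl nonint F(2) _ _ _ _ v])
      show "\<forall>r\<in>prod.swap ` R. \<forall>s\<in>prod.swap ` R. compatible \<delta> ?E' ?E r s"
        using R(4) by (intro ballI) (elim imageE, simp only: compatible_swap)
      show "prod.swap ` R \<subseteq> V \<times> V" using R(3) by auto
    qed (use R(1) \<open>F \<subseteq> fst ` prod.swap ` R\<close> in auto)
    then obtain u where "u \<in> V" and
      u: "\<And>r s. r \<in> insert (v, u) (prod.swap ` R) \<Longrightarrow> s \<in> insert (v, u) (prod.swap ` R) \<Longrightarrow>
        compatible \<delta> ?E' ?E r s"
      by blast
    have swap_in: "prod.swap r \<in> insert (v, u) (prod.swap ` R)" if "r \<in> insert (u, v) R" for r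
      using that by (elim insertE) simp_all
    have "compatible \<delta> ?E ?E' r s" if "r \<in> insert (u, v) R" "s \<in> insert (u, v) R" for r s
      using u[OF swap_in[OF that(1)] swap_in[OF that(2)]] unfolding compatible_swap .
    then show "\<exists>u\<in>V. \<forall>r\<in>insert (u, v) R. \<forall>s\<in>insert (u, v) R. compatible \<delta> ?E ?E' r s"
      using \<open>u \<in> V\<close> by blast
  next
    fix f
    assume f: "bij_betw f V V"
      "\<And>u v. u \<in> V \<Longrightarrow> v \<in> V \<Longrightarrow> compatible \<delta> ?E ?E' (u, f u) (v, f v)"
    have "{u, v} \<in> ?E \<longleftrightarrow> {f u, f v} \<in> ?E'" if "u \<in> V" "v \<in> V" for u v
      using f(2)[OF that] unfolding compatible_def by simp
    moreover have "fst (LARG V \<delta> \<omega>) = V" "fst (LARG V \<delta> \<omega>') = V"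
      by (simp_all add: LARG_def)
    ultimately show "graph_iso (LARG V \<delta> \<omega>) (LARG V \<delta> \<omega>')"
      unfolding graph_iso_def using f(1) by (intro exI[of _ f]) simp
  qed (fact V)+
qed

section \<open>From generic dense sequences to the Rado property\<close>

lemma rado_range:
  fixes x :: "nat \<Rightarrow> cseq"
  assumes dense: "closure (range x) = UNIV"
    and gen: "\<forall>i j k l n m. \<forall>(a :: int) (b :: int). i \<notin> {j, k, l} \<longrightarrow>
      ecoord (x i) n \<noteq> ecoord (x j) n + of_int a / of_int b * (ecoord (x k) m - ecoord (x l) m)"
  shows "rado (range x)"
  unfolding rado_def
proof (intro conjI allI impI ballI)
  fix \<delta> p :: real
  assume \<delta>: "\<delta> > 0" and p: "p \<in> {0<..<1}"
  show "\<exists>\<Gamma> :: cseq graph. simple_graph \<Gamma> \<and>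
      (AE \<omega> in LARG_space (range x) \<delta> p. graph_iso (LARG (range x) \<delta> \<omega>) \<Gamma>)"
  proof (rule exceptional_pair[OF gen \<delta>])
    fix F assume F: "finite F" "F \<noteq> {}" "F \<subseteq> range x"
      "\<And>u v. u \<in> F \<Longrightarrow> v \<in> F \<Longrightarrow> u \<noteq> v \<Longrightarrow> \<delta> \<le> norm (u - v)"
      "\<And>u v k. u \<in> range x \<Longrightarrow> v \<in> range x \<Longrightarrow> u \<noteq> v \<Longrightarrow> u \<notin> F \<or> v \<notin> F \<Longrightarrow>
        (ecoord u k - ecoord v k) / \<delta> \<notin> \<int>"
    have ec: "AE \<omega> in LARG_space (range x) \<delta> p. geometrically_ec (range x) \<delta> \<omega>"
      using dense p by (intro AE_geometrically_ec) auto
    interpret P: prob_space "LARG_space (range x) \<delta> p"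
      unfolding LARG_space_def by (intro prob_space_PiM prob_space_measure_pmf)
    \<comment> \<open>An almost sure property holds for at least one realisation; its graph serves
      as \<Gamma>.\<close>
    obtain \<omega>' where \<omega>': "geometrically_ec (range x) \<delta> \<omega>'"
      using eventually_happens[OF ec] P.ae_filter_bot by blast
    have "simple_graph (LARG (range x) \<delta> \<omega>')"
      unfolding simple_graph_def LARG_def close_pairs_def by auto
    moreover have "AE \<omega> in LARG_space (range x) \<delta> p.
        graph_iso (LARG (range x) \<delta> \<omega>) (LARG (range x) \<delta> \<omega>')"
      using ec by eventually_elim (rule LARG_iso[OF _ \<delta> _ \<omega>' F], auto)
    ultimately show "\<exists>\<Gamma> :: cseq graph. simple_graph \<Gamma> \<and>
        (AE \<omega> in LARG_space (range x) \<delta> p. graph_iso (LARG (range x) \<delta> \<omega>) \<Gamma>)"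
      by blast
  qed
qed (use dense in auto)

theorem theorem1p1:
  fixes \<mu> :: "cseq measure"
  assumes "prob_space \<mu>" and "sets \<mu> = sets borel"
    and "non_aligned \<mu>" and "fully_supported \<mu>"
  shows "AE x in (\<Pi>\<^sub>M i\<in>(UNIV :: nat set). \<mu>). rado (range x)"
  using AE_dense_range[OF assms(1,2,4)] AE_generic[OF assms(1-3)]
proof (rule AE_mp[OF _ AE_mp], intro AE_I2 impI)
  fix x :: "nat \<Rightarrow> cseq"
  assume "closure (range x) = UNIV"
    and "\<forall>i j k l n m. \<forall>(a :: int) (b :: int). i \<notin> {j, k, l} \<longrightarrow>
      ecoord (x i) n \<noteq> ecoord (x j) n + of_int a / of_int b * (ecoord (x k) m - ecoord (x l) m)"
  \<comment> \<open>Density and genericity mention neither \<delta> nor \<open>p\<close>, so one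
    null set of sequences serves all parameters at once.\<close>
  then show "rado (range x)" by (rule rado_range)
qed

end
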